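(* Let $1\le r,s\le\infty$ and let $(X_n)_{n\in\mathbb N}$ be an increasing sequence of finite dimensional Banach spaces. Put $X^{(r)}=\big(\sum_{n\in\mathbb N}X_n\big)_r$ and $X^{(s)}=\big(\sum_{n\in\mathbb N}X_n\big)_s$. If there is an isomorphism $T:X^{(r)}\to X^{(s)}$, then $r=s$. Consequently, the spaces $X^{(r)}$, $1\le r\le\infty$, are mutually non-isomorphic.
   Context: "Increasing" means that $X_n$ is a proper subspace of $X_{n+1}$ (with the norm inherited from $X_{n+1}$) for every $n$. For Banach spaces $X_n$, $\big(\sum_{n}X_n\big)_r$ is the space of sequences $(f_n)$ with $f_n\in X_n$ and finite norm $\big(\sum_n\|f_n\|^r\big)^{1/r}$ if $r<\infty$, respectively $\sup_n\|f_n\|$ if $r=\infty$. An isomorphism is a bounded linear bijection with bounded inverse. *)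

theory Defs
  imports "HOL-Analysis.Analysis"
begin

text \<open>
  The spaces of an increasing sequence are subspaces of their union, which is a normed space (not
  complete in general). An increasing sequence is therefore modelled inside one real normed space
  of arbitrary type, each \<open>X n\<close> carrying the ambient norm. The scalars are real: complex Banach
  spaces are covered by restriction of scalars, since being finite dimensional, being a proper
  subspace, and being isomorphic all persist, and the norms do not change.
\<close>

definition increasing_fd_banach :: "(nat \<Rightarrow> 'a::real_normed_vector set) \<Rightarrow> bool" where
  "increasing_fd_banach X \<longleftrightarrow>
     (\<forall>n. subspace (X n) \<and> complete (X n) \<and> (\<exists>B. finite B \<and> span B = X n) \<and> X n \<subset> X (Suc n))"

definition lr_sum :: "ereal \<Rightarrow> (nat \<Rightarrow> 'a::real_normed_vector set) \<Rightarrow> (nat \<Rightarrow> 'a) set" where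
  "lr_sum r X = {f. (\<forall>n. f n \<in> X n) \<and>
     (if r = \<infinity> then bdd_above (range (\<lambda>n. norm (f n)))
      else summable (\<lambda>n. norm (f n) powr real_of_ereal r))}"

definition lr_norm :: "ereal \<Rightarrow> (nat \<Rightarrow> 'a::real_normed_vector) \<Rightarrow> real" where
  "lr_norm r f =
     (if r = \<infinity> then (SUP n. norm (f n))
      else (\<Sum>n. norm (f n) powr real_of_ereal r) powr (1 / real_of_ereal r))"

text \<open>
  The exponent varies within a statement, so the spaces are carrier sets of sequences with
  pointwise operations rather than types, and linearity and boundedness are relative to the
  carriers. A map is unconstrained outside its domain.
\<close>

definition lr_bounded_linear ::
  "ereal \<Rightarrow> ereal \<Rightarrow> (nat \<Rightarrow> 'a::real_normed_vector set) \<Rightarrow> ((nat \<Rightarrow> 'a) \<Rightarrow> nat \<Rightarrow> 'a) \<Rightarrow> bool"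
where
  "lr_bounded_linear r s X T \<longleftrightarrow>
     (\<forall>f\<in>lr_sum r X. T f \<in> lr_sum s X) \<and>
     (\<forall>f\<in>lr_sum r X. \<forall>g\<in>lr_sum r X. T (\<lambda>n. f n + g n) = (\<lambda>n. T f n + T g n)) \<and>
     (\<forall>c. \<forall>f\<in>lr_sum r X. T (\<lambda>n. c *\<^sub>R f n) = (\<lambda>n. c *\<^sub>R T f n)) \<and>
     (\<exists>K. \<forall>f\<in>lr_sum r X. lr_norm s (T f) \<le> K * lr_norm r f)"

definition lr_isomorphism ::
  "ereal \<Rightarrow> ereal \<Rightarrow> (nat \<Rightarrow> 'a::real_normed_vector set) \<Rightarrow> ((nat \<Rightarrow> 'a) \<Rightarrow> nat \<Rightarrow> 'a) \<Rightarrow> bool"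
where
  "lr_isomorphism r s X T \<longleftrightarrow>
     lr_bounded_linear r s X T \<and> bij_betw T (lr_sum r X) (lr_sum s X) \<and>
     lr_bounded_linear s r X (inv_into (lr_sum r X) T)"

definition lr_isomorphic ::
  "ereal \<Rightarrow> ereal \<Rightarrow> (nat \<Rightarrow> 'a::real_normed_vector set) \<Rightarrow> bool"
where
  "lr_isomorphic r s X \<longleftrightarrow> (\<exists>T. lr_isomorphism r s X T)"

end

theory Submission
  imports Defs
begin

text \<open>
  At least one exponent is finite; replacing \<open>T\<close> by its inverse if necessary, let it be the exponent
  \<open>s\<close> of the target. As the \<open>X n\<close> are finite dimensional, for all \<open>L\<close> and \<open>M\<close> there is a unit vector
  \<open>d\<close> of finite support in \<open>[L, \<infinity>)\<close> such that \<open>T d\<close> vanishes below \<open>M\<close>. A gliding hump yields disjointly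
  supported unit vectors \<open>d\<^sub>1, \<dots>, d\<^sub>k\<close> whose images are almost disjointly supported. Their sum has
  norm \<open>k\<^bsup>1/r\<^esup>\<close>, while its image has norm comparable to \<open>k\<^bsup>1/s\<^esup>\<close>, so \<open>r = s\<close>.
\<close>

section \<open>Finitely supported sequences and common zeros of finitely many functionals\<close>

definition finsupp_sum :: "(nat \<Rightarrow> 'a::real_normed_vector set) \<Rightarrow> (nat \<Rightarrow> 'a) set" where
  "finsupp_sum X = {f. (\<forall>n. f n \<in> X n) \<and> (\<exists>L. \<forall>n\<ge>L. f n = 0)}"

lemma finsupp_sum_add:
  assumes "\<And>n. subspace (X n)" "f \<in> finsupp_sum X" "g \<in> finsupp_sum X"
  shows "(\<lambda>n. f n + g n) \<in> finsupp_sum X"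
proof -
  obtain L M where "\<forall>n\<ge>L. f n = 0" "\<forall>n\<ge>M. g n = 0"
    using assms unfolding finsupp_sum_def by auto
  then have "\<exists>L. \<forall>n\<ge>L. f n + g n = 0" by (intro exI[of _ "max L M"]) simp
  then show ?thesis
    using assms unfolding finsupp_sum_def by (simp add: subspace_add)
qed

lemma finsupp_sum_scaleR:
  assumes "\<And>n. subspace (X n)" "f \<in> finsupp_sum X"
  shows "(\<lambda>n. c *\<^sub>R f n) \<in> finsupp_sum X"
  using assms unfolding finsupp_sum_def by (auto intro!: subspace_scale)

text \<open>The inclusion is uniform in the exponent, so all blocks can be built in
  \<open>finsupp_sum X\<close>, where linear combinations raise no convergence question, and then
  measured in either norm.\<close>

lemma finsupp_sum_subset_lr_sum:
  assumes "f \<in> finsupp_sum X"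
  shows "f \<in> lr_sum r X"
proof -
  obtain L where L: "\<forall>n\<ge>L. f n = 0" and X: "\<forall>n. f n \<in> X n"
    using assms unfolding finsupp_sum_def by auto
  have "range (\<lambda>n. norm (f n)) \<subseteq> insert 0 ((\<lambda>n. norm (f n)) ` {..<L})"
    using L by (auto simp: image_iff) (metis lessThan_iff not_le)
  then have "bdd_above (range (\<lambda>n. norm (f n)))"
    by (meson bdd_above_finite finite_imageI finite_insert finite_lessThan finite_subset)
  moreover have "summable (\<lambda>n. norm (f n) powr real_of_ereal r)"
    by (rule summable_finite[of "{..<L}"]) (use L in auto)
  ultimately show ?thesis
    using X unfolding lr_sum_def by auto
qed

text \<open>Each functional costs one dimension, while the sequences vanishing below
  \<open>L\<close> form an infinite dimensional space by \<open>nz\<close>. The induction keeps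
  \<open>L\<close> arbitrary, so that its hypothesis also yields a second solution past the support
  of the first.\<close>

lemma common_zero_of_functionals:
  fixes X :: "nat \<Rightarrow> 'a::real_normed_vector set" and \<Phi> :: "((nat \<Rightarrow> 'a) \<Rightarrow> real) set"
  assumes sub: "\<And>n. subspace (X n)"
    and nz: "\<And>n. \<exists>m\<ge>n. \<exists>x\<in>X m. x \<noteq> 0"
    and "finite \<Phi>"
    and add: "\<And>\<phi> f g. \<phi> \<in> \<Phi> \<Longrightarrow> f \<in> finsupp_sum X \<Longrightarrow> g \<in> finsupp_sum X \<Longrightarrow>
      \<phi> (\<lambda>n. f n + g n) = \<phi> f + \<phi> g"
    and scale: "\<And>\<phi> f c. \<phi> \<in> \<Phi> \<Longrightarrow> f \<in> finsupp_sum X \<Longrightarrow> \<phi> (\<lambda>n. c *\<^sub>R f n) = c * \<phi> f"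
  shows "\<exists>f\<in>finsupp_sum X. (\<forall>n<L. f n = 0) \<and> (\<exists>n. f n \<noteq> 0) \<and> (\<forall>\<phi>\<in>\<Phi>. \<phi> f = 0)"
  using assms(3-5)
proof (induction \<Phi> arbitrary: L rule: finite_induct)
  case empty
  obtain m x where m: "m \<ge> L" "x \<in> X m" "x \<noteq> 0" using nz by blast
  define f where "f = (\<lambda>n. if n = m then x else 0)"
  have "\<exists>L. \<forall>n\<ge>L. f n = 0" by (rule exI[of _ "Suc m"]) (simp add: f_def)
  then have "f \<in> finsupp_sum X"
    using m sub unfolding finsupp_sum_def by (simp add: f_def subspace_0)
  then show ?case using m by (intro bexI[of _ f]) (auto simp: f_def)
next
  case (insert \<phi> \<Phi>)
  have IH: "\<exists>f\<in>finsupp_sum X. (\<forall>n<L. f n = 0) \<and> (\<exists>n. f n \<noteq> 0) \<and> (\<forall>\<phi>\<in>\<Phi>. \<phi> f = 0)" for L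
    using insert.IH insert.prems by blast
  obtain f where f: "f \<in> finsupp_sum X" "\<forall>n<L. f n = 0" "\<exists>n. f n \<noteq> 0" "\<forall>\<phi>\<in>\<Phi>. \<phi> f = 0"
    using IH by blast
  show ?case
  proof (cases "\<phi> f = 0")
    case True
    then show ?thesis using f by blast
  next
    case False
    \<comment> \<open>Starting \<open>g\<close> beyond the support of \<open>f\<close> makes the two
      linearly independent.\<close>
    obtain L' where L': "\<forall>n\<ge>L'. f n = 0" using f(1) unfolding finsupp_sum_def by auto
    obtain g where g: "g \<in> finsupp_sum X" "\<forall>n<max L L'. g n = 0" "\<exists>n. g n \<noteq> 0" "\<forall>\<phi>\<in>\<Phi>. \<phi> g = 0"
      using IH by blast
    obtain m where m: "g m \<noteq> 0" using g(3) by blast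
    then have "f m = 0" using g(2) L' by (meson max.cobounded2 not_le order_trans)
    \<comment> \<open>The coefficients cancel the value of \<open>\<phi>\<close>. At
      \<open>m\<close> only the second term survives, and its coefficient \<open>- \<phi> f\<close>
      is nonzero, so \<open>h\<close> is not the zero sequence.\<close>
    define h where "h = (\<lambda>n. \<phi> g *\<^sub>R f n + (- \<phi> f) *\<^sub>R g n)"
    have "h \<in> finsupp_sum X"
      unfolding h_def by (intro finsupp_sum_add finsupp_sum_scaleR sub f(1) g(1))
    moreover have "\<forall>n<L. h n = 0" using f(2) g(2) by (auto simp: h_def)
    moreover have "h m \<noteq> 0" using m \<open>f m = 0\<close> False by (simp add: h_def)
    moreover have eq: "\<psi> h = \<phi> g * \<psi> f - \<phi> f * \<psi> g" if "\<psi> \<in> insert \<phi> \<Phi>" for \<psi>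
      unfolding h_def
        insert.prems(1)[OF that finsupp_sum_scaleR finsupp_sum_scaleR, OF sub f(1) sub g(1)]
        insert.prems(2)[OF that f(1)] insert.prems(2)[OF that g(1)] by simp
    moreover have "\<forall>\<psi>\<in>insert \<phi> \<Phi>. \<psi> h = 0"
    proof
      show "\<psi> h = 0" if "\<psi> \<in> insert \<phi> \<Phi>" for \<psi>
        using eq[OF that] that f(4) g(4) by auto
    qed
    ultimately show ?thesis by blast
  qed
qed

text \<open>Finite dimensionality enters here: the coordinates of \<open>T f n\<close> in a finite
  basis of \<open>X n\<close>, for \<open>n < M\<close>, are finitely many linear functionals of
  \<open>f\<close>, and a common zero of them is what is sought.\<close>

lemma image_vanishing_initially:
  fixes X :: "nat \<Rightarrow> 'a::real_normed_vector set"
  assumes sub: "\<And>n. subspace (X n)"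
    and fd: "\<And>n. \<exists>B. finite B \<and> span B = X n"
    and nz: "\<And>n. \<exists>m\<ge>n. \<exists>x\<in>X m. x \<noteq> 0"
    and mem: "\<And>f n. f \<in> finsupp_sum X \<Longrightarrow> T f n \<in> X n"
    and add: "\<And>f g. f \<in> finsupp_sum X \<Longrightarrow> g \<in> finsupp_sum X \<Longrightarrow>
      T (\<lambda>n. f n + g n) = (\<lambda>n. T f n + T g n)"
    and scale: "\<And>f c. f \<in> finsupp_sum X \<Longrightarrow> T (\<lambda>n. c *\<^sub>R f n) = (\<lambda>n. c *\<^sub>R T f n)"
  shows "\<exists>f\<in>finsupp_sum X. (\<forall>n<L. f n = 0) \<and> (\<exists>n. f n \<noteq> 0) \<and> (\<forall>n<M. T f n = 0)"
proof -
  have "\<exists>B. finite B \<and> independent B \<and> span B = X n" for n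
  proof -
    obtain C where "finite C" "span C = X n" using fd by blast
    moreover obtain B where "B \<subseteq> C" "independent B" "C \<subseteq> span B"
      by (rule maximal_independent_subset)
    ultimately show ?thesis
      by (metis finite_subset span_mono span_span subset_antisym)
  qed
  then obtain B where B: "\<And>n. finite (B n)" "\<And>n. independent (B n)" "\<And>n. span (B n) = X n"
    by metis
  define \<Phi> where "\<Phi> = (\<lambda>(n, b) f. representation (B n) (T f n) b) ` (SIGMA n:{..<M}. B n)"
  have "finite \<Phi>" unfolding \<Phi>_def using B by auto
  then obtain f where f: "f \<in> finsupp_sum X" "\<forall>n<L. f n = 0" "\<exists>n. f n \<noteq> 0" "\<forall>\<phi>\<in>\<Phi>. \<phi> f = 0"
    using common_zero_of_functionals[OF sub nz, of \<Phi> L] unfolding \<Phi>_def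
    by (fastforce simp: add scale B mem representation_add representation_scale)
  have "T f n = 0" if "n < M" for n
  proof -
    have "T f n = (\<Sum>b\<in>B n. representation (B n) (T f n) b *\<^sub>R b)"
      using sum_representation_eq[OF B(2) _ B(1) order_refl] B(3) mem[OF f(1)] by metis
    also have "\<dots> = 0" using f(4) that by (auto simp: \<Phi>_def intro!: sum.neutral)
    finally show ?thesis .
  qed
  then show ?thesis using f by blast
qed

section \<open>The norm of a direct sum: scaling, positivity and disjoint supports\<close>

lemma lr_norm_scaleR:
  assumes "f \<in> lr_sum r X" "1 \<le> r" "\<And>n. subspace (X n)"
  shows "lr_norm r (\<lambda>n. c *\<^sub>R f n) = \<bar>c\<bar> * lr_norm r f"
proof (cases "r = \<infinity>")
  case True
  have bdd: "bdd_above (range (\<lambda>n. norm (f n)))"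
    using assms True by (simp add: lr_sum_def)
  have "(SUP n. \<bar>c\<bar> * norm (f n)) = \<bar>c\<bar> * (SUP n. norm (f n))"
    using bdd by (intro continuous_at_Sup_mono[of "(*) \<bar>c\<bar>" "range (\<lambda>n. norm (f n))", symmetric, unfolded image_image])
      (auto intro!: monoI mult_left_mono continuous_intros)
  then show ?thesis using True by (simp add: lr_norm_def)
next
  case False
  then obtain p where p: "r = ereal p" "p \<ge> 1" using \<open>1 \<le> r\<close> by (cases r) auto
  have s: "summable (\<lambda>n. norm (f n) powr p)"
    using assms p by (simp add: lr_sum_def)
  have "(\<Sum>n. norm (c *\<^sub>R f n) powr p) = \<bar>c\<bar> powr p * (\<Sum>n. norm (f n) powr p)"
    using s by (simp add: powr_mult suminf_mult)
  then show ?thesis using p s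
    by (simp add: lr_norm_def powr_mult powr_powr suminf_nonneg)
qed

lemma lr_norm_pos:
  assumes "f \<in> lr_sum r X" "1 \<le> r" "f m \<noteq> 0"
  shows "lr_norm r f > 0"
proof (cases "r = \<infinity>")
  case True
  have bdd: "bdd_above (range (\<lambda>n. norm (f n)))"
    using assms True by (simp add: lr_sum_def)
  have "0 < norm (f m)" using assms by simp
  also have "\<dots> \<le> (SUP n. norm (f n))" using bdd by (intro cSUP_upper) auto
  finally show ?thesis using True by (simp add: lr_norm_def)
next
  case False
  then obtain p where p: "r = ereal p" "p \<ge> 1" using \<open>1 \<le> r\<close> by (cases r) auto
  have "summable (\<lambda>n. norm (f n) powr p)"
    using assms p by (simp add: lr_sum_def)
  then have "(\<Sum>n. norm (f n) powr p) > 0"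
    by (rule suminf_pos2[of _ m]) (use assms in auto)
  then show ?thesis using p by (simp add: lr_norm_def)
qed

lemma lr_norm_powr:
  assumes "f \<in> lr_sum (ereal p) X" "p \<ge> 1"
  shows "lr_norm (ereal p) f powr p = (\<Sum>n. norm (f n) powr p)"
  using assms by (simp add: lr_norm_def lr_sum_def powr_powr suminf_nonneg)

text \<open>For \<open>r = \<infinity>\<close> the exponent \<open>1 / real_of_ereal r\<close> is \<open>1 / 0 = 0\<close>, and \<open>0 powr 0 = 0\<close>.\<close>

lemma lr_norm_add_disjoint:
  assumes f: "f \<in> lr_sum r X" and g: "g \<in> lr_sum r X" and "1 \<le> r"
    and disj: "\<And>n. f n = 0 \<or> g n = 0"
    and nf: "lr_norm r f = real k powr (1 / real_of_ereal r)" and ng: "lr_norm r g = 1"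
  shows "lr_norm r (\<lambda>n. f n + g n) = real (Suc k) powr (1 / real_of_ereal r)"
proof (cases "r = \<infinity>")
  case True
  have bf: "bdd_above (range (\<lambda>n. norm (f n)))" and bg: "bdd_above (range (\<lambda>n. norm (g n)))"
    using f g True by (simp_all add: lr_sum_def)
  have "norm (f n + g n) = max (norm (f n)) (norm (g n))" for n
    using disj[of n] by auto
  then have "(SUP n. norm (f n + g n)) = (SUP n. max (norm (f n)) (norm (g n)))" by simp
  also have "\<dots> = max (SUP n. norm (f n)) (SUP n. norm (g n))"
  proof (rule antisym)
    show "(SUP n. max (norm (f n)) (norm (g n))) \<le> max (SUP n. norm (f n)) (SUP n. norm (g n))"
      using bf bg by (intro cSUP_least max.mono cSUP_upper) auto
    have "bdd_above (range (\<lambda>n. max (norm (f n)) (norm (g n))))"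
    proof -
      obtain a b where "\<forall>n. norm (f n) \<le> a" "\<forall>n. norm (g n) \<le> b"
        using bf bg by (auto simp: bdd_above_def)
      then show ?thesis by (intro bdd_aboveI2[of _ _ "max a b"] max.mono) auto
    qed
    then have "max (norm (f m)) (norm (g m)) \<le> (SUP n. max (norm (f n)) (norm (g n)))" for m
      by (rule cSUP_upper[OF UNIV_I])
    then show "max (SUP n. norm (f n)) (SUP n. norm (g n)) \<le> (SUP n. max (norm (f n)) (norm (g n)))"
      by (intro max.boundedI cSUP_least) simp_all
  qed
  \<comment> \<open>By \<open>nf\<close> the first supremum is 0 if \<open>k = 0\<close> and 1
    otherwise; by \<open>ng\<close> the second is 1.\<close>
  also have "\<dots> = 1" using nf ng True by (auto simp: lr_norm_def powr_def split: if_splits)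
  finally show ?thesis using True by (simp add: lr_norm_def)
next
  case False
  then obtain p where p: "r = ereal p" "p \<ge> 1" using \<open>1 \<le> r\<close> by (cases r) auto
  have sf: "summable (\<lambda>n. norm (f n) powr p)" and sg: "summable (\<lambda>n. norm (g n) powr p)"
    using f g p by (simp_all add: lr_sum_def)
  have "norm (f n + g n) powr p = norm (f n) powr p + norm (g n) powr p" for n
    using disj[of n] by auto
  then have "(\<Sum>n. norm (f n + g n) powr p) = (\<Sum>n. norm (f n) powr p) + (\<Sum>n. norm (g n) powr p)"
    using suminf_add[OF sf sg] by simp
  also have "(\<Sum>n. norm (f n) powr p) = real k"
    using lr_norm_powr[of f p X] f nf p by (simp add: powr_powr)
  also have "(\<Sum>n. norm (g n) powr p) = 1"
    using lr_norm_powr[of g p X] g ng p by simp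
  finally show ?thesis using p by (simp add: lr_norm_def add.commute)
qed

section \<open>Power sums of almost disjoint sequences\<close>

lemma norm_add_powr_le:
  fixes x y :: "'a::real_normed_vector"
  assumes "p \<ge> 0"
  shows "norm (x + y) powr p \<le> 2 powr p * (norm x powr p + norm y powr p)"
proof -
  have "norm (x + y) powr p \<le> (2 * max (norm x) (norm y)) powr p"
    using norm_triangle_ineq[of x y] assms by (intro powr_mono2) auto
  also have "\<dots> = 2 powr p * max (norm x) (norm y) powr p" by (simp add: powr_mult)
  also have "\<dots> \<le> 2 powr p * (norm x powr p + norm y powr p)"
    by (intro mult_left_mono) (auto simp: max_def)
  finally show ?thesis .
qed

text \<open>Only the tail of \<open>u\<close> interacts with \<open>v\<close>, so the crude constant \<open>2 powr p\<close> multiplies the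
  small tail and \<open>v\<close> but never the bulk of \<open>u\<close>; hence it does not accumulate over many summands.\<close>

lemma suminf_powr_add_almost_disjoint:
  fixes u v :: "nat \<Rightarrow> 'a::real_normed_vector"
  assumes p: "p \<ge> 1"
    and su: "summable (\<lambda>n. norm (u n) powr p)" and sv: "summable (\<lambda>n. norm (v n) powr p)"
    and v0: "\<And>n. n < M \<Longrightarrow> v n = 0"
    and tail: "(\<Sum>n. norm (u (n + M)) powr p) \<le> \<tau>"
  shows "(\<Sum>n. norm (u n + v n) powr p) \<le>
      (\<Sum>n. norm (u n) powr p) + 2 powr p * (\<tau> + (\<Sum>n. norm (v n) powr p))"
    and "(\<Sum>n. norm (u n) powr p) + (\<Sum>n. norm (v n) powr p) / 2 powr p - 2 * \<tau> \<le>
      (\<Sum>n. norm (u n + v n) powr p)"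
proof -
  have s: "summable (\<lambda>n. norm (u n + v n) powr p)"
  proof (rule summable_comparison_test')
    show "summable (\<lambda>n. 2 powr p * (norm (u n) powr p + norm (v n) powr p))"
      by (intro summable_mult summable_add su sv)
    show "norm (norm (u n + v n) powr p) \<le> 2 powr p * (norm (u n) powr p + norm (v n) powr p)"
      if "n \<ge> 0" for n using norm_add_powr_le[of p "u n" "v n"] p by simp
  qed
  \<comment> \<open>These are the tails from \<open>M\<close> on of the power sums of
    \<open>u\<close>, \<open>v\<close> and \<open>u + v\<close>. Below \<open>M\<close> the
    sequences \<open>u\<close> and \<open>u + v\<close> agree, so only the tails have to be
    compared.\<close>
  define U where "U = (\<Sum>n. norm (u (n + M)) powr p)"
  define V where "V = (\<Sum>n. norm (v (n + M)) powr p)"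
  define W where "W = (\<Sum>n. norm (u (n + M) + v (n + M)) powr p)"
  have su': "summable (\<lambda>n. norm (u (n + M)) powr p)"
    and sv': "summable (\<lambda>n. norm (v (n + M)) powr p)"
    and s': "summable (\<lambda>n. norm (u (n + M) + v (n + M)) powr p)"
    using su sv s by (simp_all add: summable_iff_shift[where k=M and f="\<lambda>n. norm (_ n) powr p"]
        summable_iff_shift[where k=M and f="\<lambda>n. norm (u n + v n) powr p"])
  have u: "(\<Sum>n. norm (u n) powr p) = U + (\<Sum>n<M. norm (u n) powr p)"
    unfolding U_def by (rule suminf_split_initial_segment[OF su])
  have v: "(\<Sum>n. norm (v n) powr p) = V"
    unfolding V_def using suminf_split_initial_segment[OF sv, of M] v0 by simp
  have w: "(\<Sum>n. norm (u n + v n) powr p) = W + (\<Sum>n<M. norm (u n) powr p)"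
    unfolding W_def using suminf_split_initial_segment[OF s, of M] v0 by simp
  have "W \<le> 2 powr p * (U + V)"
    unfolding W_def U_def V_def suminf_add[OF su' sv'] suminf_mult[OF summable_add[OF su' sv'], symmetric]
    using p by (intro suminf_le norm_add_powr_le s' summable_mult summable_add su' sv') auto
  \<comment> \<open>The same crude inequality, applied to
    \<open>v = (u + v) + (- u)\<close>.\<close>
  moreover have "V \<le> 2 powr p * (W + U)"
    unfolding W_def U_def V_def suminf_add[OF s' su'] suminf_mult[OF summable_add[OF s' su'], symmetric]
  proof (intro suminf_le sv' summable_mult summable_add s' su')
    show "norm (v (n + M)) powr p
        \<le> 2 powr p * (norm (u (n + M) + v (n + M)) powr p + norm (u (n + M)) powr p)" for n
      using norm_add_powr_le[of p "u (n + M) + v (n + M)" "- u (n + M)"] p by simp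
  qed
  moreover have "U \<ge> 0" unfolding U_def by (intro suminf_nonneg su') auto
  moreover have "U \<le> \<tau>" using tail by (simp add: U_def)
  \<comment> \<open>In the lower estimate one \<open>\<tau>\<close> bounds \<open>U\<close> in the
    inequality for \<open>V\<close>; the other pays for the copy of \<open>U\<close> contained in
    the full sum of \<open>u\<close>.\<close>
  ultimately have "W \<le> 2 powr p * (\<tau> + V)" "V / 2 powr p \<le> W + \<tau>" "0 \<le> U"
    apply -
    subgoal by (smt (verit) mult_left_mono powr_ge_zero)
    subgoal by (smt (verit) mult.commute pos_divide_le_eq mult_left_mono powr_gt_zero)
    by simp
  then show "(\<Sum>n. norm (u n + v n) powr p) \<le>
      (\<Sum>n. norm (u n) powr p) + 2 powr p * (\<tau> + (\<Sum>n. norm (v n) powr p))"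
    and "(\<Sum>n. norm (u n) powr p) + (\<Sum>n. norm (v n) powr p) / 2 powr p - 2 * \<tau> \<le>
      (\<Sum>n. norm (u n + v n) powr p)"
    unfolding u v w using \<open>U \<le> \<tau>\<close> by auto
qed

section \<open>The gliding hump and the comparison of exponents\<close>

lemma powr_bounded_imp_zero:
  fixes q C :: real
  assumes "\<And>n. real n powr q \<le> C" "q \<ge> 0"
  shows "q = 0"
proof (rule ccontr)
  assume "q \<noteq> 0"
  then have "q > 0" using assms by simp
  have "filterlim (\<lambda>n. real n powr q) at_top sequentially"
    using \<open>q > 0\<close> by (intro filterlim_compose[OF real_powr_at_top filterlim_real_sequentially])
  then have "\<forall>\<^sub>F n in sequentially. real n powr q > C"
    by (simp add: filterlim_at_top_dense)
  then show False using assms(1) by (auto simp: eventually_sequentially not_le[symmetric])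
qed

text \<open>The target exponent is finite because the construction needs the tails of
  \<open>T f\<close> to become small, which fails for a supremum norm. Bounds above and below are
  all that is asked of \<open>T\<close>, so an isomorphism and its inverse can both take its
  place.\<close>

lemma exponent_eq_of_embedding:
  fixes X :: "nat \<Rightarrow> 'a::real_normed_vector set"
  assumes X: "increasing_fd_banach X" and r: "1 \<le> r" and p: "1 \<le> p"
    and T: "lr_bounded_linear r (ereal p) X T"
    and low: "\<And>f. f \<in> lr_sum r X \<Longrightarrow> lr_norm r f \<le> K * lr_norm (ereal p) (T f)"
  shows "r = ereal p"
proof -
  have sub: "subspace (X n)" and fd: "\<exists>B. finite B \<and> span B = X n" and inc: "X n \<subset> X (Suc n)" for n
    using X unfolding increasing_fd_banach_def by auto
  \<comment> \<open>\<open>X 0\<close> may be trivial, but a vector of \<open>X (Suc n)\<close>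
    outside \<open>X n\<close> is nonzero.\<close>
  have nz: "\<exists>m\<ge>n. \<exists>x\<in>X m. x \<noteq> 0" for n
  proof -
    obtain x where "x \<in> X (Suc n)" "x \<notin> X n" using inc[of n] by blast
    then show ?thesis using subspace_0[OF sub[of n]] by (intro exI[of _ "Suc n"]) (auto intro!: bexI[of _ x])
  qed
  note V = finsupp_sum_subset_lr_sum[where r = r and X = X]
  let ?N = "\<lambda>f. \<Sum>n. norm (T f n) powr p"
  have Tmem: "T f \<in> lr_sum (ereal p) X" if "f \<in> lr_sum r X" for f
    using T that unfolding lr_bounded_linear_def by blast
  have sT: "summable (\<lambda>n. norm (T f n) powr p)" if "f \<in> lr_sum r X" for f
    using Tmem[OF that] by (simp add: lr_sum_def)
  have TX: "T f n \<in> X n" if "f \<in> finsupp_sum X" for f n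
    using Tmem[OF V[OF that]] by (simp add: lr_sum_def)
  have add: "T (\<lambda>n. f n + g n) = (\<lambda>n. T f n + T g n)"
    if "f \<in> finsupp_sum X" "g \<in> finsupp_sum X" for f g
    using T V[OF that(1)] V[OF that(2)] unfolding lr_bounded_linear_def by blast
  have scale: "T (\<lambda>n. c *\<^sub>R f n) = (\<lambda>n. c *\<^sub>R T f n)" if "f \<in> finsupp_sum X" for f c
    using T V[OF that] unfolding lr_bounded_linear_def by blast
  obtain K' where K': "\<And>f. f \<in> lr_sum r X \<Longrightarrow> lr_norm (ereal p) (T f) \<le> K' * lr_norm r f"
    using T unfolding lr_bounded_linear_def by blast
  \<comment> \<open>A single constant serves both inequalities; it is at least 1 since
    \<open>K\<close> and \<open>K'\<close> could be negative.\<close>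
  define C where "C = max 1 (max K K')"
  have "C \<ge> 1" "K \<le> C" "K' \<le> C" by (auto simp: C_def)
  have nn: "lr_norm (ereal p) f \<ge> 0" for f :: "nat \<Rightarrow> 'a" by (simp add: lr_norm_def)
  have nn': "lr_norm r f \<ge> 0" if "f \<in> lr_sum r X" for f
  proof (cases "f = (\<lambda>_. 0)")
    case True
    then show ?thesis using lr_norm_scaleR[OF that r sub, of 0] by simp
  next
    case False
    then show ?thesis using lr_norm_pos[OF that r] by (fastforce simp: fun_eq_iff)
  qed
  have up: "?N f \<le> C powr p * lr_norm r f powr p" if "f \<in> lr_sum r X" for f
  proof -
    have "lr_norm (ereal p) (T f) \<le> C * lr_norm r f"
      using K'[OF that] mult_right_mono[OF \<open>K' \<le> C\<close> nn'[OF that]] by linarith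
    then have "lr_norm (ereal p) (T f) powr p \<le> (C * lr_norm r f) powr p"
      using p nn by (intro powr_mono2) auto
    then show ?thesis
      using lr_norm_powr[OF Tmem[OF that] p] nn'[OF that] \<open>C \<ge> 1\<close> by (simp add: powr_mult)
  qed
  have lo: "lr_norm r f powr p \<le> C powr p * ?N f" if "f \<in> lr_sum r X" for f
  proof -
    have "lr_norm r f \<le> C * lr_norm (ereal p) (T f)"
      using low[OF that] mult_right_mono[OF \<open>K \<le> C\<close> nn[of "T f"]] by linarith
    then have "lr_norm r f powr p \<le> (C * lr_norm (ereal p) (T f)) powr p"
      using p nn'[OF that] by (intro powr_mono2) auto
    then show ?thesis
      using lr_norm_powr[OF Tmem[OF that] p] nn \<open>C \<ge> 1\<close> by (simp add: powr_mult)
  qed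
  define D where "D = C powr p"
  have "D > 0" using \<open>C \<ge> 1\<close> by (simp add: D_def)
  \<comment> \<open>A normalized block has image power sum between \<open>1 / D\<close> and
    \<open>D\<close>. Adding it gains at least \<open>1 / D / 2 powr p = 4 * \<tau>\<close> and
    loses at most \<open>2 * \<tau>\<close>, which leaves \<open>a\<close>; the increase is at most
    \<open>b\<close>. Each step pays for its own error, so \<open>\<tau>\<close> does not depend on
    \<open>k\<close>.\<close>
  define \<tau> where "\<tau> = 1 / (4 * D * 2 powr p)"
  have "\<tau> > 0" using \<open>D > 0\<close> by (simp add: \<tau>_def)
  define a where "a = 2 * \<tau>"
  define b where "b = 2 powr p * (\<tau> + D)"
  define \<rho> where "\<rho> = 1 / real_of_ereal r"
  have main: "\<exists>f\<in>finsupp_sum X. lr_norm r f = real k powr \<rho> \<and> real k * a \<le> ?N f \<and> ?N f \<le> real k * b"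
    for k
  proof (induction k)
    case 0
    have 1: "(\<lambda>_. 0) \<in> finsupp_sum X" using sub by (simp add: finsupp_sum_def subspace_0)
    moreover have "lr_norm r (\<lambda>_. 0 :: 'a) = 0"
      using lr_norm_scaleR[OF V[OF 1] r sub, of 0] by simp
    moreover have "T (\<lambda>_. 0) = (\<lambda>_. 0)" using scale[OF 1, of 0] by simp
    ultimately show ?case by (intro bexI[of _ "\<lambda>_. 0"]) auto
  next
    case (Suc k)
    then obtain f where f: "f \<in> finsupp_sum X" "lr_norm r f = real k powr \<rho>"
      "real k * a \<le> ?N f" "?N f \<le> real k * b" by blast
    obtain L where L: "\<forall>n\<ge>L. f n = 0" using f(1) unfolding finsupp_sum_def by auto
    \<comment> \<open>Convergence of the power sum of \<open>T f\<close> provides the cut-off after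
      which the image of the next block may start.\<close>
    obtain M where M: "(\<Sum>n. norm (T f (n + M)) powr p) \<le> \<tau>"
    proof -
      obtain M where "\<forall>n\<ge>M. norm (\<Sum>i. norm (T f (i + n)) powr p) < \<tau>"
        using suminf_exist_split[OF \<open>\<tau> > 0\<close> sT[OF V[OF f(1)]]] by blast
      then have "norm (\<Sum>i. norm (T f (i + M)) powr p) < \<tau>" by blast
      then show ?thesis by (intro that[of M]) simp
    qed
    \<comment> \<open>The next hump: \<open>g\<close> is disjoint from \<open>f\<close>, and
      \<open>T g\<close> meets only the small tail of \<open>T f\<close>. Normalizing
      \<open>g\<close> preserves both properties.\<close>
    obtain g where g: "g \<in> finsupp_sum X" "\<forall>n<L. g n = 0" "\<exists>n. g n \<noteq> 0" "\<forall>n<M. T g n = 0"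
      using image_vanishing_initially[where X = X and T = T and L = L and M = M, OF sub fd nz TX add scale]
      by blast
    define c where "c = lr_norm r g"
    have "c > 0" using g(3) lr_norm_pos[OF V[OF g(1)] r] by (auto simp: c_def)
    define h where "h = (\<lambda>n. (1 / c) *\<^sub>R g n)"
    have h: "h \<in> finsupp_sum X" unfolding h_def by (intro finsupp_sum_scaleR sub g(1))
    have nh: "lr_norm r h = 1"
      unfolding h_def lr_norm_scaleR[OF V[OF g(1)] r sub] using \<open>c > 0\<close> by (simp add: c_def)
    have Th: "T h n = 0" if "n < M" for n
      using scale[OF g(1), of "1 / c"] g(4) that by (simp add: h_def)
    have disj: "f n = 0 \<or> h n = 0" for n
      using L g(2) by (cases "n < L") (auto simp: h_def)
    note est = suminf_powr_add_almost_disjoint[OF p sT[OF V[OF f(1)]] sT[OF V[OF h]] Th M]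
    let ?fh = "\<lambda>n. f n + h n"
    have Nfh: "?N ?fh = (\<Sum>n. norm (T f n + T h n) powr p)" by (simp add: add[OF f(1) h])
    have hup: "?N h \<le> D" using up[OF V[OF h]] nh by (simp add: D_def)
    have "1 / D \<le> ?N h" using lo[OF V[OF h]] nh \<open>D > 0\<close> by (simp add: D_def field_simps)
    then have "1 / D / 2 powr p \<le> ?N h / 2 powr p" by (intro divide_right_mono) auto
    moreover have "1 / D / 2 powr p = 4 * \<tau>" using \<open>D > 0\<close> by (simp add: \<tau>_def field_simps)
    ultimately have "real (Suc k) * a \<le> ?N ?fh"
      using est(2) f(3) unfolding Nfh a_def by (simp add: algebra_simps)
    moreover have "?N ?fh \<le> real (Suc k) * b"
    proof -
      have "2 powr p * (\<tau> + ?N h) \<le> b"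
        unfolding b_def using hup by (intro mult_left_mono) auto
      then show ?thesis using est(1) f(4) unfolding Nfh by (simp add: algebra_simps)
    qed
    moreover have "lr_norm r ?fh = real (Suc k) powr \<rho>"
      using lr_norm_add_disjoint[OF V[OF f(1)] V[OF h] r disj _ nh] f(2) by (simp add: \<rho>_def)
    ultimately show ?case using finsupp_sum_add[OF sub f(1) h] by blast
  qed
  \<comment> \<open>The \<open>p\<close>-th power of the norm of the sum of \<open>k\<close> blocks
    is \<open>real k powr (\<rho> * p)\<close>, while that of its image grows linearly in
    \<open>k\<close>.\<close>
  have bounds: "real k * a \<le> D * real k powr (\<rho> * p)" "real k powr (\<rho> * p) \<le> D * (real k * b)" for k
  proof -
    obtain f where f: "f \<in> finsupp_sum X" "lr_norm r f = real k powr \<rho>"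
      "real k * a \<le> ?N f" "?N f \<le> real k * b" using main by blast
    show "real k * a \<le> D * real k powr (\<rho> * p)"
      using up[OF V[OF f(1)]] f(2,3) by (simp add: powr_powr D_def)
    have "real k powr (\<rho> * p) \<le> D * ?N f"
      using lo[OF V[OF f(1)]] f(2) by (simp add: powr_powr D_def)
    also have "\<dots> \<le> D * (real k * b)" using f(4) \<open>D > 0\<close> by simp
    finally show "real k powr (\<rho> * p) \<le> D * (real k * b)" .
  qed
  have "a > 0" "b > 0" using \<open>\<tau> > 0\<close> \<open>D > 0\<close> by (auto simp: a_def b_def)
  have "\<rho> * p = 1"
  \<comment> \<open>Dividing the appropriate bound by the smaller power of \<open>k\<close> leaves a
    bounded power with exponent the absolute value of \<open>1 - \<rho> * p\<close>, which must
    therefore vanish.\<close>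
  proof (cases "\<rho> * p \<le> 1")
    case True
    have "real k powr (1 - \<rho> * p) \<le> D / a" for k
      using bounds(1)[of k] \<open>a > 0\<close> \<open>D > 0\<close> by (cases "k = 0") (auto simp: powr_diff field_simps)
    from powr_bounded_imp_zero[OF this] True show ?thesis by simp
  next
    case False
    have "real k powr (\<rho> * p - 1) \<le> D * b" for k
      using bounds(2)[of k] \<open>b > 0\<close> \<open>D > 0\<close> by (cases "k = 0") (auto simp: powr_diff field_simps)
    from powr_bounded_imp_zero[OF this] False show ?thesis by simp
  qed
  \<comment> \<open>For \<open>r = \<infinity>\<close> the convention \<open>1 / 0 = 0\<close> gives
    \<open>\<rho> * p = 0\<close>, which is excluded; otherwise \<open>\<rho> * p\<close> is the
    quotient of \<open>p\<close> by \<open>r\<close>.\<close>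
  then show ?thesis using r p by (cases r) (auto simp: \<rho>_def field_simps)
qed

text \<open>Unless both exponents are infinite, \<open>T\<close> or its inverse maps into a sum with
  finite exponent. The upper bound for either map is the lower bound for the other, so the embedding
  result applies.\<close>

lemma exponent_eq_of_isomorphism:
  assumes X: "increasing_fd_banach X" and r: "1 \<le> r" and s: "1 \<le> s"
    and T: "lr_isomorphism r s X T"
  shows "r = s"
proof -
  let ?S = "inv_into (lr_sum r X) T"
  have bl: "lr_bounded_linear r s X T" "lr_bounded_linear s r X ?S"
    and bij: "bij_betw T (lr_sum r X) (lr_sum s X)"
    using T by (auto simp: lr_isomorphism_def)
  obtain K where K: "\<And>f. f \<in> lr_sum r X \<Longrightarrow> lr_norm s (T f) \<le> K * lr_norm r f"
    using bl(1) unfolding lr_bounded_linear_def by blast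
  obtain K' where K': "\<And>f. f \<in> lr_sum s X \<Longrightarrow> lr_norm r (?S f) \<le> K' * lr_norm s f"
    using bl(2) unfolding lr_bounded_linear_def by blast
  \<comment> \<open>Here the inverse is the embedding; its lower bound is the bound \<open>K\<close>
    of \<open>T\<close> at \<open>?S f\<close>, since \<open>T (?S f) = f\<close>.\<close>
  have "s = r" if "r = ereal q" for q
    unfolding that
  proof (rule exponent_eq_of_embedding[OF X s _ bl(2)[unfolded that]])
    show "1 \<le> q" using r that by simp
    show "lr_norm s f \<le> K * lr_norm (ereal q) (inv_into (lr_sum (ereal q) X) T f)"
      if "f \<in> lr_sum s X" for f
      using K[of "?S f"] that bij bij_betw_inv_into_right[OF bij that] \<open>r = ereal q\<close>
        bl(2)[unfolded lr_bounded_linear_def] by auto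
  qed
  moreover have "r = s" if "s = ereal q" for q
    unfolding that
  proof (rule exponent_eq_of_embedding[OF X r _ bl(1)[unfolded that]])
    show "1 \<le> q" using s that by simp
    show "lr_norm r f \<le> K' * lr_norm (ereal q) (T f)" if "f \<in> lr_sum r X" for f
      using K'[of "T f"] that bij_betw_inv_into_left[OF bij that] \<open>s = ereal q\<close>
        bl(1)[unfolded lr_bounded_linear_def] by auto
  qed
  ultimately show ?thesis using r s by (cases r; cases s) auto
qed

theorem theorem5p6:
  fixes X :: "nat \<Rightarrow> 'a::real_normed_vector set"
  assumes "increasing_fd_banach X"
  shows "(\<forall>(r::ereal) (s::ereal) T. 1 \<le> r \<longrightarrow> 1 \<le> s \<longrightarrow> lr_isomorphism r s X T \<longrightarrow> r = s) \<and>
         pairwise (\<lambda>r s. \<not> lr_isomorphic r s X) {1..\<infinity>}"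
  using exponent_eq_of_isomorphism[OF assms] by (auto simp: pairwise_def lr_isomorphic_def)

end
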